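(* Let $(S,+)$ be a semigroup, $d\in\mathbb{N}$ and $p$ an idempotent in $(\beta S,+)$. Then for every finite coloring of $S^d$ there exist a color $i$ (determined by $p$ and the coloring) and an assignment, to each finite (possibly empty) sequence $(a_0,\dots,a_{n-1})$ in $S$, of a set $C_{n;a_0,\dots,a_{n-1}}\in p$, such that every sequence $(a_n)_{n\ge0}$ in $S$ with $a_n\in C_{n;a_0,\dots,a_{n-1}}$ for all $n\ge 0$ has the property that the set \[\bigcup_{\substack{(m_0,\dots,m_d)\in\mathbb{Z}^{d+1}\\ 0\le m_0<m_1<\dots<m_d}}\{(x_1,\dots,x_d):\ x_i\in\mathrm{FS}(a_{m_{i-1}},\dots,a_{m_i-1})\text{ for each }1\le i\le d\}\] has color $i$.
   Context: Semigroups are infinite (discrete) and not assumed commutative. $\beta S$ is the set of ultrafilters on $S$; the operation extends by $A\in p+q$ iff $\{s\in S: A-s\in q\}\in p$, where $A-s=\{t\in S: s+t\in A\}$; $p$ is idempotent if $p+p=p$. For $m\le n$, $\mathrm{FS}(a_m,\dots,a_n)=\{a_{\alpha_1}+\dots+a_{\alpha_k}: \{\alpha_1<\dots<\alpha_k\}\subseteq\{m,\dots,n\},\ k\ge1\}$ (summed in increasing order of index). *)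

theory Defs
  imports Complex_Main "HOL-Library.FuncSet"
begin

text \<open>
  Ultrafilters on the type \<open>'a\<close> are elements of the library type \<open>'a filter\<close>; the membership
  \<open>A \<in> p\<close> is \<open>eventually (\<lambda>s. s \<in> A) p\<close>.
\<close>

definition beta :: "'a filter set" where
  "beta = {p. p \<noteq> bot \<and> (\<forall>A. eventually (\<lambda>s. s \<in> A) p \<or> eventually (\<lambda>s. s \<notin> A) p)}"

definition shift :: "'a::semigroup_add set \<Rightarrow> 'a \<Rightarrow> 'a set" where
  "shift A s = {t. s + t \<in> A}"

text \<open>\<open>A \<in> p + q\<close> iff \<open>{s. A - s \<in> q} \<in> p\<close>; see \<open>mem_filter_add_iff\<close> below.\<close>

definition filter_add :: "'a::semigroup_add filter \<Rightarrow> 'a filter \<Rightarrow> 'a filter" where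
  "filter_add p q =
     Abs_filter (\<lambda>P. eventually (\<lambda>s. eventually (\<lambda>t. t \<in> shift (Collect P) s) q) p)"

lemma eventually_filter_add:
  "eventually P (filter_add p q) \<longleftrightarrow> eventually (\<lambda>s. eventually (\<lambda>t. P (s + t)) q) p"
proof -
  have "is_filter (\<lambda>P. eventually (\<lambda>s. eventually (\<lambda>t. P (s + t)) q) p)"
  proof
    show "\<forall>\<^sub>F s in p. \<forall>\<^sub>F t in q. P (s + t) \<and> Q (s + t)"
      if "\<forall>\<^sub>F s in p. \<forall>\<^sub>F t in q. P (s + t)" "\<forall>\<^sub>F s in p. \<forall>\<^sub>F t in q. Q (s + t)" for P Q
      using that by (simp add: eventually_conj_iff)
    show "\<forall>\<^sub>F s in p. \<forall>\<^sub>F t in q. Q (s + t)"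
      if "\<forall>x. P x \<longrightarrow> Q x" "\<forall>\<^sub>F s in p. \<forall>\<^sub>F t in q. P (s + t)" for P Q
      using that(2) by (rule eventually_mono) (use that(1) in \<open>auto elim: eventually_mono\<close>)
  qed simp
  then show ?thesis
    by (simp add: filter_add_def shift_def eventually_Abs_filter)
qed

lemma mem_filter_add_iff:
  "eventually (\<lambda>s. s \<in> A) (filter_add p q) \<longleftrightarrow>
     eventually (\<lambda>s. s \<in> {s. eventually (\<lambda>t. t \<in> shift A s) q}) p"
  by (simp add: eventually_filter_add shift_def)

lemma filter_add_in_beta:
  assumes "p \<in> beta" "q \<in> beta"
  shows "filter_add p q \<in> beta"
proof -
  have ultra: "eventually (\<lambda>s. \<not> P s) r \<longleftrightarrow> \<not> eventually P r" if "r \<in> beta" for P and r :: "'a filter"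
  proof
    assume "eventually (\<lambda>s. \<not> P s) r"
    then show "\<not> eventually P r"
      using that eventually_frequently[of r P] by (auto simp: beta_def frequently_def)
  next
    assume "\<not> eventually P r"
    then show "eventually (\<lambda>s. \<not> P s) r"
      using that unfolding beta_def by (auto dest: spec[of _ "Collect P"])
  qed
  have "eventually (\<lambda>s. s \<in> A) (filter_add p q) \<or> eventually (\<lambda>s. s \<notin> A) (filter_add p q)" for A
    by (simp add: eventually_filter_add ultra assms)
  moreover have "filter_add p q \<noteq> bot"
    using assms by (simp add: trivial_limit_def eventually_filter_add) (simp add: beta_def trivial_limit_def)
  ultimately show ?thesis
    by (simp add: beta_def)
qed

text \<open>A semigroup need not have a zero, so \<open>sum_list\<close> is not available; only nonempty lists matter.\<close>

fun ordered_sum :: "'a::semigroup_add list \<Rightarrow> 'a" where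
  "ordered_sum [x] = x"
| "ordered_sum (x # y # xs) = x + ordered_sum (y # xs)"

definition FS :: "(nat \<Rightarrow> 'a::semigroup_add) \<Rightarrow> nat \<Rightarrow> nat \<Rightarrow> 'a set" where
  "FS a m n = {ordered_sum (map a \<alpha>) |\<alpha>. \<alpha> \<noteq> [] \<and> sorted_wrt (<) \<alpha> \<and> set \<alpha> \<subseteq> {m..n}}"

text \<open>
  A tuple \<open>(x\<^sub>1, \<dots>, x\<^sub>d)\<close> is a list \<open>x\<close> of length \<open>d\<close>, so that \<open>x\<^sub>i\<close> is \<open>x ! (i - 1)\<close>.
  Only the values \<open>m 0 < \<dots> < m d\<close> of the function \<open>m\<close> are relevant; in particular \<open>m i \<ge> 1\<close>
  for \<open>i \<ge> 1\<close>, so the natural-number subtractions do not truncate.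
\<close>

definition FS_tuples :: "nat \<Rightarrow> (nat \<Rightarrow> 'a::semigroup_add) \<Rightarrow> 'a list set" where
  "FS_tuples d a =
     (\<Union>m \<in> {m :: nat \<Rightarrow> nat. strict_mono_on {0..d} m}.
        {x. length x = d \<and> (\<forall>i\<in>{1..d}. x ! (i - 1) \<in> FS a (m (i - 1)) (m i - 1))})"

end

(*
  Let i be the color of (x_1,...,x_d) for p-almost all x_1, for p-almost all x_2, ..., for
  p-almost all x_d.
  Call a tuple of length j \<le> d good if p-almost all of its iterated extensions have color i.
  A good tuple x of length j < d has a set G_x in p of good one-point extensions, and as p + p = p,
  the set G_x* of those s in G_x with G_x - s in p is again in p, with G_x* - s in p
  for all s in G_x*.  Hence one can demand of each new term a_n that, for every good tuple x of
  sums of earlier terms, a_n lies in G_x* and b + a_n lies in G_x* for every earlier sum b in G_x*.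
*)
theory Submission
  imports Defs
begin

text \<open>Membership in the \<open>n\<close>-fold tensor power of \<open>p\<close>. The first
  entry is quantified outermost, so the set of good next entries may depend on the entries before
  it.\<close>

primrec eventually_lists :: "'a filter \<Rightarrow> nat \<Rightarrow> ('a list \<Rightarrow> bool) \<Rightarrow> bool" where
  "eventually_lists p 0 P \<longleftrightarrow> P []"
| "eventually_lists p (Suc n) P \<longleftrightarrow> eventually (\<lambda>s. eventually_lists p n (\<lambda>x. P (s # x))) p"

lemma ultrafilter_pigeonhole:
  assumes "p \<in> beta" "finite K" "eventually (\<lambda>s. \<exists>i\<in>K. P i s) p"
  shows "\<exists>i\<in>K. eventually (P i) p"
proof (rule ccontr)
  assume "\<not> ?thesis"
  moreover have "eventually (P i) p \<or> eventually (\<lambda>s. \<not> P i s) p" for i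
    using assms(1) unfolding beta_def by (auto dest: spec[of _ "Collect (P i)"])
  ultimately have "\<forall>i\<in>K. eventually (\<lambda>s. \<not> P i s) p"
    by blast
  then have "eventually (\<lambda>s. \<forall>i\<in>K. \<not> P i s) p"
    using assms(2) by (simp add: eventually_ball_finite_distrib)
  with assms(3) have "eventually (\<lambda>s. False) p"
    by eventually_elim blast
  then show False
    using assms(1) by (simp add: beta_def trivial_limit_def)
qed

text \<open>Fixing the first entry \<open>s\<close> leaves a coloring of shorter lists, whose color
  depends on \<open>s\<close>; the ultrafilter then selects one color for almost all
  \<open>s\<close>.\<close>

lemma eventually_lists_pigeonhole:
  assumes "p \<in> beta" "finite K" "c \<in> {x. length x = d} \<rightarrow> K"
  shows "\<exists>i\<in>K. eventually_lists p d (\<lambda>x. c x = i)"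
  using assms(3)
proof (induction d arbitrary: c)
  case 0
  then show ?case by auto
next
  case (Suc d)
  have "\<exists>i\<in>K. eventually_lists p d (\<lambda>x. c (s # x) = i)" for s
    using Suc.prems by (intro Suc.IH) auto
  then show ?case
    using ultrafilter_pigeonhole[OF assms(1,2)] by simp
qed

text \<open>The set usually written \<open>A\<^sup>\<star>\<close>.\<close>

definition star :: "'a::semigroup_add filter \<Rightarrow> 'a set \<Rightarrow> 'a set" where
  "star p A = {s \<in> A. eventually (\<lambda>t. s + t \<in> A) p}"

lemma eventually_star:
  assumes "filter_add p p = p" "eventually (\<lambda>s. s \<in> A) p"
  shows "eventually (\<lambda>s. s \<in> star p A) p"
proof -
  have "eventually (\<lambda>s. s \<in> A) (filter_add p p)"
    using assms by simp
  with assms(2) show ?thesis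
    unfolding star_def eventually_filter_add by (simp add: eventually_conj_iff)
qed

text \<open>Idempotence is applied to the translate of \<open>A\<close> by \<open>s\<close>;
  associativity turns the result into the star condition at \<open>s + t\<close>.\<close>

lemma eventually_add_star:
  assumes "filter_add p p = p" "s \<in> star p A"
  shows "eventually (\<lambda>t. s + t \<in> star p A) p"
proof -
  have *: "eventually (\<lambda>t. s + t \<in> A) p"
    using assms(2) by (simp add: star_def)
  then have "eventually (\<lambda>t. s + t \<in> A) (filter_add p p)"
    using assms(1) by simp
  with * show ?thesis
    unfolding star_def eventually_filter_add by (simp add: eventually_conj_iff add.assoc)
qed

lemma ordered_sum_snoc: "xs \<noteq> [] \<Longrightarrow> ordered_sum (xs @ [y]) = ordered_sum xs + y"
  by (induction xs rule: ordered_sum.induct) (auto simp: add.assoc)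

text \<open>A finite superset of the sums of subsequences of \<open>as\<close>.\<close>

definition list_sums :: "'a::semigroup_add list \<Rightarrow> 'a set" where
  "list_sums as = ordered_sum ` {ys. set ys \<subseteq> set as \<and> length ys \<le> length as}"

lemma finite_list_sums: "finite (list_sums as)"
  unfolding list_sums_def by (intro finite_imageI finite_lists_length_le) simp

lemma list_sums_mono: "m \<le> n \<Longrightarrow> list_sums (map a [0..<m]) \<subseteq> list_sums (map a [0..<n])"
  unfolding list_sums_def by (intro image_mono) auto

lemma ordered_sum_in_list_sums:
  assumes "sorted_wrt (<) \<alpha>" "set \<alpha> \<subseteq> {..<n}"
  shows "ordered_sum (map a \<alpha>) \<in> list_sums (map a [0..<n])"
proof -
  have "length \<alpha> = card (set \<alpha>)"
    using assms(1) by (simp add: distinct_card strict_sorted_iff)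
  also have "\<dots> \<le> n"
    using card_mono[OF _ assms(2)] by simp
  finally show ?thesis
    using assms(2) unfolding list_sums_def by (intro imageI) auto
qed

text \<open>Dependent choice, used for uniqueness of the color: it yields a sequence obeying two
  assignments at once.\<close>

lemma exists_sequence:
  fixes C :: "'a list \<Rightarrow> 'a set"
  assumes "\<And>as. \<exists>s. s \<in> C as"
  shows "\<exists>a :: nat \<Rightarrow> 'a. \<forall>n. a n \<in> C (map a [0..<n])"
proof -
  define h where "h as = (SOME s. s \<in> C as)" for as
  define pre where "pre = rec_nat [] (\<lambda>n as. as @ [h as])"
  define a where "a n = h (pre n)" for n
  have "pre n = map a [0..<n]" for n
    by (induction n) (simp_all add: pre_def a_def)
  moreover have "h as \<in> C as" for as
    unfolding h_def using assms by (rule someI_ex)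
  ultimately have "\<forall>n. a n \<in> C (map a [0..<n])"
    unfolding a_def by metis
  then show ?thesis by blast
qed

lemma FS_tuples_nonempty: "FS_tuples d a \<noteq> {}"
proof -
  have "a n \<in> FS a n n" for n
    unfolding FS_def by (rule CollectI, rule exI[of _ "[n]"]) simp
  then have "map a [0..<d] \<in> FS_tuples d a"
    unfolding FS_tuples_def by (intro UN_I[of id]) (auto simp: strict_mono_on_def)
  then show ?thesis by blast
qed

text \<open>Goodness of \<open>[]\<close> is \<open>eventually_lists p d P\<close>, and for lists of
  length \<open>d\<close> it is \<open>P\<close> itself.\<close>

definition good :: "'a filter \<Rightarrow> nat \<Rightarrow> ('a list \<Rightarrow> bool) \<Rightarrow> 'a list \<Rightarrow> bool" where
  "good p d P x \<longleftrightarrow> eventually_lists p (d - length x) (\<lambda>y. P (x @ y))"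

lemma eventually_good_snoc:
  assumes "good p d P x" "length x < d"
  shows "eventually (\<lambda>s. good p d P (x @ [s])) p"
proof -
  have "d - length x = Suc (d - Suc (length x))"
    using assms(2) by simp
  with assms(1) show ?thesis
    by (simp add: good_def)
qed

definition good_star :: "'a::semigroup_add filter \<Rightarrow> nat \<Rightarrow> ('a list \<Rightarrow> bool) \<Rightarrow> 'a list \<Rightarrow> 'a set" where
  "good_star p d P x = star p {s. good p d P (x @ [s])}"

text \<open>\<open>x\<close> and \<open>b\<close> range over finite sets, so this is a finite
  intersection of members of \<open>p\<close>. Extra elements of \<open>list_sums as\<close>, such
  as the unspecified \<open>ordered_sum []\<close>, only add finitely many such conditions.\<close>

definition admissible :: "'a::semigroup_add filter \<Rightarrow> nat \<Rightarrow> ('a list \<Rightarrow> bool) \<Rightarrow> 'a list \<Rightarrow> 'a set" where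
  "admissible p d P as =
     {s. \<forall>x \<in> {x. set x \<subseteq> list_sums as \<and> length x \<le> d}. length x < d \<longrightarrow> good p d P x \<longrightarrow>
           s \<in> good_star p d P x \<and>
           (\<forall>b \<in> list_sums as. b \<in> good_star p d P x \<longrightarrow> b + s \<in> good_star p d P x)}"

lemma eventually_admissible:
  assumes "filter_add p p = p"
  shows "eventually (\<lambda>s. s \<in> admissible p d P as) p"
proof -
  have "eventually (\<lambda>s. s \<in> good_star p d P x \<and>
      (\<forall>b \<in> list_sums as. b \<in> good_star p d P x \<longrightarrow> b + s \<in> good_star p d P x)) p"
    if "good p d P x" "length x < d" for x
  proof (intro eventually_conj eventually_ball_finite finite_list_sums ballI)
    show "eventually (\<lambda>s. s \<in> good_star p d P x) p"
      unfolding good_star_def using eventually_good_snoc[OF that]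
      by (intro eventually_star assms) simp
    show "eventually (\<lambda>s. b \<in> good_star p d P x \<longrightarrow> b + s \<in> good_star p d P x) p" for b
      unfolding good_star_def
      using eventually_add_star[OF assms] by (cases "b \<in> star p {s. good p d P (x @ [s])}") auto
  qed
  then show ?thesis
    unfolding admissible_def mem_Collect_eq
    by (intro eventually_ball_finite finite_lists_length_le finite_list_sums ballI)
      (auto simp: eventually_conj_iff)
qed

text \<open>Induction removes the largest index \<open>k\<close>: \<open>a k\<close> was chosen
  after all other terms of the sum, and since \<open>k\<close> is at least \<open>m\<close>, also
  after the terms making up \<open>x\<close>.\<close>

lemma ordered_sum_in_good_star:
  assumes a: "\<And>n. a n \<in> admissible p d P (map a [0..<n])"
    and x: "good p d P x" "length x < d" "set x \<subseteq> list_sums (map a [0..<m])"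
  shows "\<alpha> \<noteq> [] \<Longrightarrow> sorted_wrt (<) \<alpha> \<Longrightarrow> set \<alpha> \<subseteq> {m..} \<Longrightarrow>
    ordered_sum (map a \<alpha>) \<in> good_star p d P x"
proof (induction \<alpha> rule: rev_induct)
  case (snoc k \<alpha>)
  have "set x \<subseteq> list_sums (map a [0..<k])"
    using x(3) list_sums_mono[of m k a] snoc.prems by auto
  then have k: "a k \<in> good_star p d P x"
      "\<And>b. b \<in> list_sums (map a [0..<k]) \<Longrightarrow> b \<in> good_star p d P x \<Longrightarrow> b + a k \<in> good_star p d P x"
    using a[of k] x(1,2) by (auto simp: admissible_def)
  show ?case
  proof (cases "\<alpha> = []")
    case True
    then show ?thesis using k(1) by simp
  next
    case False
    have "ordered_sum (map a \<alpha>) \<in> list_sums (map a [0..<k])"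
      using snoc.prems by (intro ordered_sum_in_list_sums) (auto simp: sorted_wrt_append)
    moreover have "ordered_sum (map a \<alpha>) \<in> good_star p d P x"
      using snoc False by (auto simp: sorted_wrt_append)
    ultimately show ?thesis
      using k(2) False by (simp add: ordered_sum_snoc)
  qed
qed simp

lemma FS_tuples_good:
  assumes a: "\<And>n. a n \<in> admissible p d P (map a [0..<n])"
    and P: "eventually_lists p d P" and x: "x \<in> FS_tuples d a"
  shows "P x"
proof -
  obtain m where m: "strict_mono_on {0..d} m" and len: "length x = d"
    and FS: "\<And>i. i \<in> {1..d} \<Longrightarrow> x ! (i - 1) \<in> FS a (m (i - 1)) (m i - 1)"
    using x unfolding FS_tuples_def by auto
  \<comment> \<open>Block by block: the second conjunct says that the prefix was already available
    when the terms of the next block were chosen.\<close>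
  have "good p d P (take j x) \<and> set (take j x) \<subseteq> list_sums (map a [0..<m j])" if "j \<le> d" for j
    using that
  proof (induction j)
    case 0
    then show ?case using P by (simp add: good_def)
  next
    case (Suc j)
    have less: "m j < m (Suc j)"
      using Suc.prems by (intro strict_mono_onD[OF m]) auto
    obtain \<alpha> where \<alpha>: "x ! j = ordered_sum (map a \<alpha>)" "\<alpha> \<noteq> []" "sorted_wrt (<) \<alpha>"
        "set \<alpha> \<subseteq> {m j..m (Suc j) - 1}"
      using FS[of "Suc j"] Suc.prems by (auto simp: FS_def)
    have "x ! j \<in> good_star p d P (take j x)"
      unfolding \<alpha>(1) using Suc \<alpha> len by (intro ordered_sum_in_good_star[OF a]) auto
    \<comment> \<open>By \<open>less\<close>, \<open>m (Suc j)\<close> is positive, so indices up to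
      \<open>m (Suc j) - 1\<close> are exactly those below \<open>m (Suc j)\<close>.\<close>
    moreover have "x ! j \<in> list_sums (map a [0..<m (Suc j)])"
      unfolding \<alpha>(1) using \<alpha>(3,4) less by (intro ordered_sum_in_list_sums) fastforce+
    moreover have "take (Suc j) x = take j x @ [x ! j]"
      using Suc.prems len by (simp add: take_Suc_conv_app_nth)
    ultimately show ?case
      using Suc list_sums_mono[of "m j" "m (Suc j)" a] less
      by (auto simp: good_star_def star_def)
  qed
  from this[of d] show ?thesis
    using len by (simp add: good_def)
qed

text \<open>Unique existence expresses that the color is determined by \<open>p\<close> and
  \<open>c\<close>.\<close>

theorem theorem5p1:
  fixes p :: "'a::semigroup_add filter"
    and d :: nat
    and c :: "'a list \<Rightarrow> 'c"
    and K :: "'c set"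
  assumes "infinite (UNIV :: 'a set)"
    and "p \<in> beta"
    and "filter_add p p = p"
    and "finite K"
    and "c \<in> {x. length x = d} \<rightarrow> K"
  shows "\<exists>!i. i \<in> K \<and>
    (\<exists>C :: 'a list \<Rightarrow> 'a set.
       (\<forall>as. eventually (\<lambda>s. s \<in> C as) p) \<and>
       (\<forall>a :: nat \<Rightarrow> 'a.
          (\<forall>n. a n \<in> C (map a [0..<n])) \<longrightarrow> (\<forall>x \<in> FS_tuples d a. c x = i)))"
proof (rule ex_ex1I, goal_cases)
  case 1
  obtain i where i: "i \<in> K" "eventually_lists p d (\<lambda>x. c x = i)"
    using eventually_lists_pigeonhole[OF assms(2,4,5)] by blast
  have "\<forall>x \<in> FS_tuples d a. c x = i"
    if "\<forall>n. a n \<in> admissible p d (\<lambda>x. c x = i) (map a [0..<n])" for a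
    using FS_tuples_good[OF spec[OF that] i(2)] by blast
  then show ?case
    using i(1) eventually_admissible[OF assms(3)] by blast
next
  case (2 i j)
  then obtain C D where C: "\<And>as. eventually (\<lambda>s. s \<in> C as) p"
      "\<And>a x. \<forall>n. a n \<in> C (map a [0..<n]) \<Longrightarrow> x \<in> FS_tuples d a \<Longrightarrow> c x = i"
    and D: "\<And>as. eventually (\<lambda>s. s \<in> D as) p"
      "\<And>a x. \<forall>n. a n \<in> D (map a [0..<n]) \<Longrightarrow> x \<in> FS_tuples d a \<Longrightarrow> c x = j"
    by blast
  \<comment> \<open>Members of \<open>p\<close> meet, so some sequence obeys both \<open>C\<close>
    and \<open>D\<close>; any of its tuples has both colors \<open>i\<close> and
    \<open>j\<close>.\<close>
  have "\<exists>s. s \<in> C as \<inter> D as" for as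
    using eventually_conj[OF C(1) D(1), of as as] assms(2)
    by (auto simp: beta_def dest!: eventually_happens)
  then obtain a where "\<forall>n. a n \<in> C (map a [0..<n]) \<inter> D (map a [0..<n])"
    using exists_sequence[of "\<lambda>as. C as \<inter> D as"] by blast
  moreover obtain x where "x \<in> FS_tuples d a"
    using FS_tuples_nonempty by blast
  ultimately show ?case
    using C(2)[of a x] D(2)[of a x] by simp
qed

end
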